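(* Let $n$ be a positive integer. Then the following holds. (1) If $n$ has exactly one (distinct) prime factor $p$, then $$\mathbb{C}[\mathbf{x}]^{D} = \mathbb{C}[\mathbf{x}]^{\Delta} = \mathbb{C}[\Theta_{p}(\mathbf{y}^{(p)}_{i}) \mid 0 \leq i \leq n_{p} - 1].$$ (2) If $n$ has exactly two (distinct) prime factors $p$ and $q$, then $$\mathbb{C}[\mathbf{x}]^{D} = \mathbb{C}[\mathbf{x}]^{\Delta} = \mathbb{C}[\Theta_{p}(\mathbf{y}^{(p)}_{i}), \Theta_{q}(\mathbf{y}^{(q)}_{j}) \mid 0 \leq i\leq n_{p} - 1,\ 0 \leq j \leq n_{q} - 1].$$
   Context: Let $\mathbf{x} = (x_0, \ldots, x_{n-1})$ be variables and $\mathbb{C}[\mathbf{x}] = \mathbb{C}[x_0,\ldots,x_{n-1}]$ the polynomial ring. With the conventions $x_{-1} := x_{n-1}$ and $x_n := x_0$, define the differential operators $$D := \sum_{i=0}^{n-1} x_{i-1}\frac{\partial}{\partial x_i}, \qquad \Delta := \sum_{i=0}^{n-1} x_{i+1}\frac{\partial}{\partial x_i},$$ and $\mathbb{C}[\mathbf{x}]^{D} := \{f \in \mathbb{C}[\mathbf{x}] \mid Df = 0\}$, $\mathbb{C}[\mathbf{x}]^{\Delta} := \{f \in \mathbb{C}[\mathbf{x}] \mid \Delta f = 0\}$. For $m \ge 1$ and elements $u_0,\ldots,u_{m-1}$ of a commutative ring, $\Theta_m(u_0,\ldots,u_{m-1})$ denotes the circulant determinant of order $m$, i.e. the determinant of the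 $m\times m$ matrix whose $(r,s)$ entry ($0 \le r,s \le m-1$) is $u_{(r-s) \bmod m}$. Let $\zeta_n \in \mathbb{C}$ be a primitive $n$-th root of unity. For a positive divisor $p$ of $n$ put $n_p := n/p$, and for $0 \le i \le n_p - 1$ let $\mathbf{y}^{(p)}_i := (y^{(p)}_{i,0}, \ldots, y^{(p)}_{i,p-1})$, where $$y^{(p)}_{i,j} := \sum_{l=0}^{n_p-1} \zeta_n^{i(j+pl)} x_{j+pl} \quad (0 \le j \le p-1).$$ For a family of elements of $\mathbb{C}[\mathbf{x}]$, $\mathbb{C}[\ldots]$ denotes the $\mathbb{C}$-subalgebra of $\mathbb{C}[\mathbf{x}]$ generated by them. *)

theory Defs
  imports
    Complex_Main
    "HOL-Library.Poly_Mapping"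
    "HOL-Computational_Algebra.Primes"
    "Jordan_Normal_Form.Determinant"
begin

text \<open>Polynomials over the complex numbers in variables indexed by \<^typ>\<open>nat\<close>: a monomial is its
  finitely supported exponent function, a polynomial its finitely supported coefficient function,
  and multiplication is the convolution product of \<^theory>\<open>HOL-Library.Poly_Mapping\<close>.\<close>

type_synonym cpoly = "(nat \<Rightarrow>\<^sub>0 nat) \<Rightarrow>\<^sub>0 complex"

definition Const :: "complex \<Rightarrow> cpoly" where
  "Const c = Poly_Mapping.single 0 c"

definition X :: "nat \<Rightarrow> cpoly" where
  "X i = Poly_Mapping.single (Poly_Mapping.single i 1) 1"

definition polyring :: "nat \<Rightarrow> cpoly set" where
  "polyring n = {f. \<forall>m\<in>Poly_Mapping.keys f. Poly_Mapping.keys m \<subseteq> {..<n}}"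

text \<open>Where the exponent of the \<open>i\<close>-th variable is 0, the truncated subtraction is harmless because
  the coefficient vanishes.\<close>

definition partial :: "nat \<Rightarrow> cpoly \<Rightarrow> cpoly" where
  "partial i f = (\<Sum>m\<in>Poly_Mapping.keys f.
     Poly_Mapping.single (m - Poly_Mapping.single i 1)
       (of_nat (Poly_Mapping.lookup m i) * Poly_Mapping.lookup f m))"

definition D_op :: "nat \<Rightarrow> cpoly \<Rightarrow> cpoly" where
  "D_op n f = (\<Sum>i<n. X ((i + n - 1) mod n) * partial i f)"

definition Delta_op :: "nat \<Rightarrow> cpoly \<Rightarrow> cpoly" where
  "Delta_op n f = (\<Sum>i<n. X ((i + 1) mod n) * partial i f)"

definition constants_D :: "nat \<Rightarrow> cpoly set" where
  "constants_D n = {f \<in> polyring n. D_op n f = 0}"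

definition constants_Delta :: "nat \<Rightarrow> cpoly set" where
  "constants_Delta n = {f \<in> polyring n. Delta_op n f = 0}"

definition subalgebra :: "cpoly set \<Rightarrow> bool" where
  "subalgebra A \<longleftrightarrow> range Const \<subseteq> A \<and> (\<forall>f\<in>A. \<forall>g\<in>A. f + g \<in> A \<and> f * g \<in> A)"

text \<open>The hull is taken in the polynomial ring in all variables. For generators in \<open>polyring n\<close>,
  itself a subalgebra, this agrees with the hull inside \<open>polyring n\<close>.\<close>

definition generated_algebra :: "cpoly set \<Rightarrow> cpoly set" where
  "generated_algebra S = subalgebra hull S"

text \<open>For \<open>r, s < m\<close>, the natural number \<open>(r + m - s) mod m\<close> is the residue of \<open>r - s\<close> modulo \<open>m\<close>.\<close>

definition circulant_det :: "nat \<Rightarrow> (nat \<Rightarrow> 'a :: comm_ring_1) \<Rightarrow> 'a" where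
  "circulant_det m u = det (mat m m (\<lambda>(r, s). u ((r + m - s) mod m)))"

definition primitive_root_of_unity :: "nat \<Rightarrow> complex \<Rightarrow> bool" where
  "primitive_root_of_unity n z \<longleftrightarrow> z ^ n = 1 \<and> (\<forall>k. 0 < k \<and> k < n \<longrightarrow> z ^ k \<noteq> 1)"

definition yvar :: "nat \<Rightarrow> complex \<Rightarrow> nat \<Rightarrow> nat \<Rightarrow> nat \<Rightarrow> cpoly" where
  "yvar n \<zeta> p i j = (\<Sum>l<n div p. Const (\<zeta> ^ (i * (j + p * l))) * X (j + p * l))"

definition Theta :: "nat \<Rightarrow> complex \<Rightarrow> nat \<Rightarrow> nat \<Rightarrow> cpoly" where
  "Theta n \<zeta> p i = circulant_det p (yvar n \<zeta> p i)"

end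

theory Submission
  imports Defs "HOL-Number_Theory.Cong"
begin

text \<open>The operators \<open>D\<close> and \<open>\<Delta>\<close> shift the variables cyclically, so the discrete Fourier transform
diagonalises both: with \<open>z\<^sub>m = (\<Sum>j<n. \<zeta>^(m j) x\<^sub>j)\<close> one has \<open>D z\<^sub>m = \<zeta>^m z\<^sub>m\<close> and
\<open>\<Delta> z\<^sub>m = \<zeta>^(-m) z\<^sub>m\<close>. Since they are derivations, each monomial \<open>\<Prod>i<n. z\<^sub>i^(a i)\<close> is an
eigenvector, for \<open>D\<close> with eigenvalue \<open>\<Sum>i<n. a i \<zeta>^i\<close>, for \<open>\<Delta>\<close> with the same sum formed with
\<open>\<zeta>^(-1)\<close>. These monomials span the polynomial ring, and the kernel of a diagonal operator is spanned
by the eigenvectors of eigenvalue 0 (\<open>kernel_of_diagonal_operator\<close>). So both kernels are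
spanned by the monomials whose exponents form a vanishing sum of \<open>n\<close>-th roots of unity.

On the other side, a circulant determinant is the product of the eigenvalues of its matrix, and for
\<open>\<Theta>\<^sub>p(y\<^sub>i)\<close> these are Fourier variables again: \<open>\<Theta>\<^sub>p(y\<^sub>i) = (\<Prod>k<p. z\<^bsub>i + k n/p\<^esub>)\<close> (\<open>Theta_eq_prod\<close>). Its
exponents are the vertices of a regular \<open>p\<close>-gon, the most obvious vanishing sum.

What remains is arithmetic: if \<open>p\<close> and \<open>q\<close> are the only primes dividing \<open>n\<close>, every vanishing
sum of \<open>n\<close>-th roots of unity with natural coefficients \<open>a\<close> is a sum of regular \<open>p\<close>-gons
and \<open>q\<close>-gons (Lam and Leung). By induction it is enough to find one polygon inside the support
(\<open>vanishing_sum_contains_polygon\<close>). The sum stays 0 when \<open>\<zeta>\<close> is replaced by a conjugate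
\<open>\<zeta>^k\<close> with \<open>k\<close> coprime to \<open>n\<close> (\<open>vanishing_sum_galois_conjugate\<close>), so the Fourier transform of
\<open>a\<close> lives on the multiples of \<open>p\<close> and of \<open>q\<close>. Hence the mixed second difference of \<open>a\<close> along the
subgroups of order \<open>p\<close> and \<open>q\<close> is 0:
\<open>a(i) + a(i + s + t) = a(i + s) + a(i + t)\<close>. If \<open>a(i) > 0\<close>, but the \<open>p\<close>-gon and the \<open>q\<close>-gon through
\<open>i\<close> both contained a zero of \<open>a\<close>, these two zeros would give a right-hand side 0 and a positive
left-hand side.

This argument also works for \<open>p = q\<close>, so prime powers and numbers with two prime factors are
treated together. The conjugates are reached by Landau's argument: raising to the power of a prime \<open>r\<close> is
additive modulo \<open>r\<close>, and a value divisible by arbitrarily large primes is 0.\<close>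

section \<open>Galois conjugates of vanishing sums of roots of unity\<close>

text \<open>The error term is kept inside the sub-semiring \<open>R\<close>. In a field of characteristic 0 every element is
a multiple of \<open>r\<close>, and only the membership \<open>w \<in> R\<close> makes the congruence meaningful.\<close>

lemma freshmans_dream_subsemiring:
  fixes x :: "'b \<Rightarrow> 'a :: comm_semiring_1"
  assumes r: "prime r" and zero: "0 \<in> R" and one: "1 \<in> R"
    and add: "\<And>u v. u \<in> R \<Longrightarrow> v \<in> R \<Longrightarrow> u + v \<in> R"
    and mult: "\<And>u v. u \<in> R \<Longrightarrow> v \<in> R \<Longrightarrow> u * v \<in> R"
    and fin: "finite S" and x: "\<And>s. s \<in> S \<Longrightarrow> x s \<in> R"
  shows "\<exists>w\<in>R. (\<Sum>s\<in>S. x s) ^ r = (\<Sum>s\<in>S. x s ^ r) + of_nat r * w"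
proof -
  have nat: "of_nat k \<in> R" for k
    by (induction k) (auto intro: zero one add)
  have pow: "u ^ k \<in> R" if "u \<in> R" for u k
    using that by (induction k) (auto intro: one mult)
  have sum: "sum g K \<in> R" if "finite K" "\<And>k. k \<in> K \<Longrightarrow> g k \<in> R" for g :: "nat \<Rightarrow> 'a" and K
    using that by (induction K rule: finite_induct) (auto intro: zero add)
  have two: "\<exists>w\<in>R. (u + v) ^ r = u ^ r + v ^ r + of_nat r * w" if "u \<in> R" "v \<in> R" for u v
  proof -
    define w where "w = (\<Sum>k\<in>{1..<r}. of_nat ((r choose k) div r) * u ^ k * v ^ (r - k))"
    have "r > 0" using r by (simp add: prime_gt_0_nat)
    have "(u + v) ^ r = (\<Sum>k\<le>r. of_nat (r choose k) * u ^ k * v ^ (r - k))"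
      by (rule binomial_ring)
    also have "{..r} = insert 0 (insert r {1..<r})"
      by auto
    also have "(\<Sum>k\<in>\<dots>. of_nat (r choose k) * u ^ k * v ^ (r - k)) =
        v ^ r + (u ^ r + (\<Sum>k\<in>{1..<r}. of_nat (r choose k) * u ^ k * v ^ (r - k)))"
      using \<open>r > 0\<close> by simp
    also have "(\<Sum>k\<in>{1..<r}. of_nat (r choose k) * u ^ k * v ^ (r - k)) = of_nat r * w"
      unfolding w_def sum_distrib_left
    proof (rule sum.cong)
      fix k assume k: "k \<in> {1..<r}"
      hence "r dvd (r choose k)"
        using r by (intro dvd_choose_prime) auto
      hence "of_nat (r choose k) = of_nat r * (of_nat ((r choose k) div r) :: 'a)"
        by (metis dvd_mult_div_cancel of_nat_mult)
      thus "of_nat (r choose k) * u ^ k * v ^ (r - k) =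
          of_nat r * (of_nat ((r choose k) div r) * u ^ k * v ^ (r - k))"
        by (simp add: mult.assoc)
    qed simp
    finally have "(u + v) ^ r = u ^ r + v ^ r + of_nat r * w"
      by (simp add: algebra_simps)
    moreover have "w \<in> R"
      unfolding w_def using that by (intro sum mult nat pow) auto
    ultimately show ?thesis by blast
  qed
  from fin x have "(\<Sum>s\<in>S. x s) \<in> R \<and> (\<exists>w\<in>R. (\<Sum>s\<in>S. x s) ^ r = (\<Sum>s\<in>S. x s ^ r) + of_nat r * w)"
  proof (induction S rule: finite_induct)
    case empty
    show ?case using r zero by (auto simp: power_0_left prime_gt_0_nat intro!: bexI[of _ 0])
  next
    case (insert s S)
    then obtain w where w: "w \<in> R" "(\<Sum>s\<in>S. x s) ^ r = (\<Sum>s\<in>S. x s ^ r) + of_nat r * w"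
      and S: "(\<Sum>s\<in>S. x s) \<in> R" by auto
    obtain w' where w': "w' \<in> R"
      "(x s + (\<Sum>s\<in>S. x s)) ^ r = x s ^ r + (\<Sum>s\<in>S. x s) ^ r + of_nat r * w'"
      using two[OF insert.prems[of s] S] by auto
    have "(x s + (\<Sum>s\<in>S. x s)) ^ r = (x s ^ r + (\<Sum>s\<in>S. x s ^ r)) + of_nat r * (w + w')"
      by (simp add: w' w algebra_simps)
    with insert w(1) w'(1) S add show ?case
      by (auto intro!: bexI[of _ "w + w'"])
  qed
  thus ?thesis by blast
qed

text \<open>A rational functional on \<open>\<complex>\<close>, taken from a basis over \<open>\<rat>\<close> that contains \<open>\<alpha>\<close>, replaces an
integral basis of the ring generated by a root of unity: divisibility in that ring becomes divisibility of
integers.\<close>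

lemma exists_additive_rational_functional:
  fixes \<alpha> :: complex
  assumes "\<alpha> \<noteq> 0"
  shows "\<exists>\<phi> :: complex \<Rightarrow> rat. (\<forall>x y. \<phi> (x + y) = \<phi> x + \<phi> y) \<and> \<phi> \<alpha> \<noteq> 0"
proof -
  interpret V: vector_space_pair "\<lambda>q x. of_rat q * x :: complex" "(*) :: rat \<Rightarrow> rat \<Rightarrow> rat"
    by unfold_locales (auto simp: algebra_simps of_rat_add of_rat_mult)
  have "V.vs1.independent {\<alpha>}"
    using assms by (simp add: V.vs1.dependent_single)
  from V.linear_independent_extend[OF this, of "\<lambda>_. 1"]
  obtain \<phi> where lin: "Vector_Spaces.linear (\<lambda>q x. of_rat q * x) (*) \<phi>" and val: "\<phi> \<alpha> = 1"
    by auto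
  interpret Vector_Spaces.linear "\<lambda>q x. of_rat q * x :: complex" "(*)" \<phi> by (fact lin)
  from add val show ?thesis by (intro exI[of _ \<phi>]) simp
qed

lemma exists_additive_functional_integral_on:
  fixes \<alpha> :: complex
  assumes "\<alpha> \<noteq> 0" and "finite F"
  shows "\<exists>\<psi> :: complex \<Rightarrow> rat. (\<forall>x y. \<psi> (x + y) = \<psi> x + \<psi> y) \<and> \<psi> ` F \<subseteq> \<int> \<and> \<psi> \<alpha> \<noteq> 0"
proof -
  obtain \<phi> :: "complex \<Rightarrow> rat" where add: "\<And>x y. \<phi> (x + y) = \<phi> x + \<phi> y" and "\<phi> \<alpha> \<noteq> 0"
    using exists_additive_rational_functional[OF assms(1)] by blast
  from \<open>finite F\<close> have "\<exists>d :: int. d \<noteq> 0 \<and> (\<forall>x\<in>F. of_int d * \<phi> x \<in> \<int>)"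
  proof (induction F rule: finite_induct)
    case empty
    show ?case by (auto intro: exI[of _ 1])
  next
    case (insert x F)
    then obtain d where d: "d \<noteq> 0" "\<And>x. x \<in> F \<Longrightarrow> of_int d * \<phi> x \<in> \<int>" by blast
    obtain a b where ab: "quotient_of (\<phi> x) = (a, b)" by fastforce
    have b: "b > 0" "\<phi> x = of_int a / of_int b"
      using quotient_of_denom_pos[OF ab] quotient_of_div[OF ab] by auto
    have "of_int (d * b) * \<phi> y \<in> \<int>" if "y \<in> insert x F" for y
    proof (cases "y = x")
      case True
      have "of_int (d * b) * \<phi> x = of_int (d * a)" using b by simp
      thus ?thesis using True by (metis Ints_of_int)
    next
      case False
      with that d(2)[of y] have dy: "of_int d * \<phi> y \<in> \<int>" by simp
      have "of_int b * (of_int d * \<phi> y) \<in> \<int>" by (rule Ints_mult[OF Ints_of_int dy])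
      also have "of_int b * (of_int d * \<phi> y) = of_int (d * b) * \<phi> y" by simp
      finally show ?thesis .
    qed
    with d(1) b(1) show ?case by (intro exI[of _ "d * b"]) auto
  qed
  then obtain d :: int where "d \<noteq> 0" "\<And>x. x \<in> F \<Longrightarrow> of_int d * \<phi> x \<in> \<int>" by blast
  with \<open>\<phi> \<alpha> \<noteq> 0\<close> show ?thesis
    by (intro exI[of _ "\<lambda>x. of_int d * \<phi> x"]) (auto simp: add ring_distribs)
qed

lemma power_eq_power_cong:
  fixes z :: "'a :: monoid_mult"
  assumes "z ^ n = 1" and "[i = j] (mod n)"
  shows "z ^ i = z ^ j"
proof -
  have "z ^ k = z ^ (k mod n)" for k
    using assms(1) by (metis div_mult_mod_eq mult.commute mult.left_neutral power_add power_mult power_one)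
  thus ?thesis using assms(2) unfolding cong_def by metis
qed

text \<open>Write \<open>f(z) = (\<Sum>i<n. a i z^i)\<close>. Modulo \<open>r\<close> the \<open>r\<close>-th power of \<open>f(z^k) = 0\<close> is \<open>f(z^(r k))\<close>, so the
latter is \<open>r\<close> times an element \<open>w\<close> of a ring on which \<open>\<psi>\<close> is integral.\<close>

lemma dvd_functional_of_vanishing_sum:
  fixes z :: complex and a :: "nat \<Rightarrow> nat" and \<psi> :: "complex \<Rightarrow> rat"
  assumes r: "prime r" and z: "z ^ n = 1" "n > 0"
    and add: "\<And>x y. \<psi> (x + y) = \<psi> x + \<psi> y"
    and int: "\<And>i. i < n \<Longrightarrow> \<psi> (z ^ i) \<in> \<int>"
    and zero: "(\<Sum>i<n. of_nat (a i) * z ^ (k * i)) = 0"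
  shows "\<exists>c \<in> \<int>. \<psi> (\<Sum>i<n. of_nat (a i) * z ^ (r * k * i)) = of_nat r * c"
proof -
  have \<psi>0: "\<psi> 0 = 0" using add[of 0 0] by simp
  have \<psi>nat: "\<psi> (of_nat m * x) = of_nat m * \<psi> x" for m x
    by (induction m) (auto simp: \<psi>0 add ring_distribs)
  have int': "\<psi> (z ^ i) \<in> \<int>" for i
  proof -
    have "z ^ i = z ^ (i mod n)" by (rule power_eq_power_cong[OF z(1)]) (simp add: cong_def)
    thus ?thesis using int[of "i mod n"] z(2) by simp
  qed
  (* L is a lattice, closed under multiplication by z, on which \<psi> is integral. Its multiplier ring R
     contains z, and \<psi> is integral on R because 1 lies in L. *)
  define L where "L = {v. \<forall>i. \<psi> (v * z ^ i) \<in> \<int>}"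
  define R where "R = {x. \<forall>v\<in>L. x * v \<in> L}"
  have L_add: "u + v \<in> L" if "u \<in> L" "v \<in> L" for u v
    using that by (auto simp: L_def ring_distribs add)
  have L_0: "0 \<in> L" by (simp add: L_def \<psi>0)
  have L_1: "1 \<in> L" by (simp add: L_def int')
  have L_z: "z ^ j * v \<in> L" if "v \<in> L" for j v
    using that by (auto simp: L_def mult_ac simp flip: power_add)
  (* Counting each power of z with multiplicity makes every summand a pure power of z, so the r-th
     powers of the summands of f(z^k) are exactly the summands of f(z^(r k)). *)
  define S where "S = Sigma {..<n} (\<lambda>i. {..<a i})"
  have sum_S: "(\<Sum>s\<in>S. g (fst s)) = (\<Sum>i<n. of_nat (a i) * g i)" for g :: "nat \<Rightarrow> complex"
    unfolding S_def by (subst sum.Sigma[symmetric, where g = "\<lambda>i j. g i", simplified split_def]) auto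
  have "\<exists>w\<in>R. (\<Sum>s\<in>S. z ^ (k * fst s)) ^ r = (\<Sum>s\<in>S. (z ^ (k * fst s)) ^ r) + of_nat r * w"
  proof (rule freshmans_dream_subsemiring[OF r])
    show "finite S" by (simp add: S_def)
  qed (auto simp: R_def L_0 L_add L_z ring_distribs mult.assoc)
  then obtain w where w: "w \<in> R"
    "(\<Sum>s\<in>S. z ^ (k * fst s)) ^ r = (\<Sum>s\<in>S. (z ^ (k * fst s)) ^ r) + of_nat r * w" by blast
  have "(\<Sum>s\<in>S. (z ^ (k * fst s)) ^ r) = (\<Sum>i<n. of_nat (a i) * z ^ (r * k * i))"
    by (subst sum_S[of "\<lambda>i. (z ^ (k * i)) ^ r"]) (simp add: power_mult[symmetric] mult_ac)
  moreover have "(\<Sum>s\<in>S. z ^ (k * fst s)) ^ r = 0"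
    using zero r by (subst sum_S[of "\<lambda>i. z ^ (k * i)"]) (simp add: power_0_left prime_gt_0_nat)
  ultimately have "0 = (\<Sum>i<n. of_nat (a i) * z ^ (r * k * i)) + of_nat r * w"
    using w(2) by simp
  hence "0 = \<psi> (\<Sum>i<n. of_nat (a i) * z ^ (r * k * i)) + of_nat r * \<psi> w"
    using \<psi>0 add \<psi>nat by metis
  moreover have "\<psi> w \<in> \<int>"
  proof -
    have "w * 1 \<in> L" using w(1) L_1 unfolding R_def by blast
    hence "\<psi> (w * z ^ 0) \<in> \<int>" unfolding L_def mult_1_right by blast
    thus ?thesis by simp
  qed
  ultimately show ?thesis
    by (intro bexI[of _ "- \<psi> w"]) (auto simp: eq_neg_iff_add_eq_0)
qed

text \<open>With \<open>f(z) = (\<Sum>i<n. a i z^i)\<close> there are only finitely many values \<open>f(z^m)\<close>. For each nonzero one a functional \<open>\<psi>\<close> gives a fixed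
nonzero integer, which only finitely many primes divide. A prime beyond all of these bounds can only
lead to \<open>f(z^(r k)) = 0\<close>.\<close>

lemma vanishing_sum_large_prime_conjugate:
  fixes z :: complex and a :: "nat \<Rightarrow> nat"
  assumes z: "z ^ n = 1" "n > 0"
  shows "\<exists>A. \<forall>r k. prime r \<longrightarrow> r > A \<longrightarrow> (\<Sum>i<n. of_nat (a i) * z ^ (k * i)) = 0 \<longrightarrow>
           (\<Sum>i<n. of_nat (a i) * z ^ (r * k * i)) = 0"
proof -
  define \<alpha> where "\<alpha> = (\<lambda>m. \<Sum>i<n. of_nat (a i) * z ^ (m * i))"
  have \<alpha>_mod: "\<alpha> m = \<alpha> (m mod n)" for m
    unfolding \<alpha>_def
    by (intro sum.cong refl arg_cong2[where f = "(*)"] power_eq_power_cong[OF z(1)] cong_mult)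
       (simp_all add: cong_def)
  have "\<exists>N :: nat. \<forall>r k. prime r \<longrightarrow> r > N \<longrightarrow> \<alpha> k = 0 \<longrightarrow> (r * k) mod n = m \<longrightarrow> \<alpha> (r * k) = 0" for m
  proof (cases "\<alpha> m = 0")
    case True
    thus ?thesis by (metis \<alpha>_mod mod_mod_trivial)
  next
    case False
    obtain \<psi> :: "complex \<Rightarrow> rat" where \<psi>: "\<And>x y. \<psi> (x + y) = \<psi> x + \<psi> y"
      "\<psi> ` insert (\<alpha> m) ((\<lambda>i. z ^ i) ` {..<n}) \<subseteq> \<int>" "\<psi> (\<alpha> m) \<noteq> 0"
      using exists_additive_functional_integral_on[OF False, of "insert (\<alpha> m) ((\<lambda>i. z ^ i) ` {..<n})"]
      by auto
    obtain N :: int where N: "\<psi> (\<alpha> m) = of_int N" using \<psi>(2) by (auto elim!: Ints_cases)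
    have "N \<noteq> 0" using N \<psi>(3) by auto
    have bound: "r \<le> nat \<bar>N\<bar>" if r: "prime r" and k: "\<alpha> k = 0" "(r * k) mod n = m" for r k
    proof -
      obtain c where c: "c \<in> \<int>" "\<psi> (\<alpha> (r * k)) = of_nat r * c"
        using dvd_functional_of_vanishing_sum[OF r z \<psi>(1), where a=a and k=k] \<psi>(2) k(1)
        by (auto simp: \<alpha>_def)
      then obtain c' where "c = of_int c'" by (auto elim: Ints_cases)
      hence "of_int N = (of_int (int r * c') :: rat)"
        using c N \<alpha>_mod[of "r * k"] k(2) \<alpha>_mod[of m] by simp
      hence "int r dvd N" by (metis dvdI of_int_eq_iff)
      with \<open>N \<noteq> 0\<close> have "int r \<le> \<bar>N\<bar>" using dvd_imp_le_int[of N "int r"] by simp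
      thus ?thesis by simp
    qed
    show ?thesis
    proof (intro exI[of _ "nat \<bar>N\<bar>"] allI impI)
      fix r k assume "prime r" "nat \<bar>N\<bar> < r" "\<alpha> k = 0" "(r * k) mod n = m"
      with bound[of r k] show "\<alpha> (r * k) = 0" by linarith
    qed
  qed
  then obtain N where N: "\<And>m r k. prime r \<Longrightarrow> r > N m \<Longrightarrow> \<alpha> k = 0 \<Longrightarrow> (r * k) mod n = m \<Longrightarrow> \<alpha> (r * k) = 0"
    by metis
  have "\<alpha> (r * k) = 0" if "prime r" "r > (\<Sum>m<n. N m)" "\<alpha> k = 0" for r k
  proof (rule N[OF that(1) _ that(3) refl])
    have "N ((r * k) mod n) \<le> (\<Sum>m<n. N m)"
      using z(2) by (intro member_le_sum) auto
    thus "N ((r * k) mod n) < r" using that(2) by linarith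
  qed
  thus ?thesis unfolding \<alpha>_def by blast
qed

text \<open>Landau's argument: the exponent \<open>k\<close> only matters modulo \<open>n\<close>, and a residue coprime to \<open>n\<close>
contains a number all of whose prime factors exceed a given bound. The previous lemma is then
applied to one prime factor after the other.\<close>

theorem vanishing_sum_galois_conjugate:
  fixes z :: complex and a :: "nat \<Rightarrow> nat"
  assumes z: "z ^ n = 1" "n > 0" and zero: "(\<Sum>i<n. of_nat (a i) * z ^ i) = 0" and k: "coprime k n"
  shows "(\<Sum>i<n. of_nat (a i) * z ^ (k * i)) = 0"
proof -
  obtain A where A: "\<And>r k. prime r \<Longrightarrow> r > A \<Longrightarrow> (\<Sum>i<n. of_nat (a i) * z ^ (k * i)) = 0 \<Longrightarrow>
           (\<Sum>i<n. of_nat (a i) * z ^ (r * k * i)) = 0"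
    using vanishing_sum_large_prime_conjugate[OF z] by blast
  have large: "(\<Sum>i<n. of_nat (a i) * z ^ (u * i)) = 0" if "\<And>r. prime r \<Longrightarrow> r dvd u \<Longrightarrow> r > A" "u \<noteq> 0" for u
    using that
  proof (induction u rule: prime_divisors_induct)
    case (unit u)
    thus ?case using zero by simp
  next
    case (factor r u)
    hence "(\<Sum>i<n. of_nat (a i) * z ^ (u * i)) = 0" by auto
    with A[of r u] factor show ?case by auto
  qed simp
  (* A prime s up to A divides exactly one of k and n * P: if it divides k, it divides neither n nor P;
     otherwise it divides P. Hence no such prime divides k + n * P. *)
  define P where "P = \<Prod>{s. prime s \<and> s \<le> A \<and> \<not> s dvd k}"
  have fin: "finite {s. prime s \<and> s \<le> A \<and> \<not> s dvd k}" by (rule finite_subset[of _ "{..A}"]) auto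
  have "(\<Sum>i<n. of_nat (a i) * z ^ ((k + n * P) * i)) = 0"
  proof (rule large)
    fix s :: nat assume s: "prime s" "s dvd k + n * P"
    show "s > A"
    proof (rule ccontr)
      assume "\<not> s > A"
      show False
      proof (cases "s dvd k")
        case True
        hence "s dvd n * P" using s(2) by (simp add: dvd_add_right_iff)
        moreover have "\<not> s dvd n" using k True s(1) by (metis coprime_common_divisor_nat not_prime_1)
        moreover have "\<not> s dvd P"
        proof
          assume "s dvd P"
          then obtain t where "t \<in> {s. prime s \<and> s \<le> A \<and> \<not> s dvd k}" "s dvd t"
            unfolding P_def using prime_dvd_prod_iff[OF fin s(1), of "\<lambda>x. x"] by auto
          thus False using s(1) True primes_dvd_imp_eq[of s t] by auto
        qed
        ultimately show False using s(1) by (simp add: prime_dvd_mult_iff)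
      next
        case False
        hence "s dvd P" unfolding P_def using s(1) \<open>\<not> s > A\<close> fin by (intro dvd_prodI[of _ _ "\<lambda>x. x"]) auto
        hence "s dvd k" using s(2) by (simp add: dvd_add_left_iff)
        with False show False by simp
      qed
    qed
  next
    have "P > 0" unfolding P_def by (intro prod_pos) (auto simp: prime_gt_0_nat)
    thus "k + n * P \<noteq> 0" using z(2) by simp
  qed
  moreover have "z ^ ((k + n * P) * i) = z ^ (k * i)" for i
    by (intro power_eq_power_cong[OF z(1)] cong_mult) (simp_all add: cong_def)
  ultimately show ?thesis by simp
qed

section \<open>Regular polygons inside vanishing sums\<close>

lemma primitive_root_power_eq_1D:
  assumes "primitive_root_of_unity n z" "n > 0" "z ^ j = 1"
  shows "n dvd j"
proof -
  have "z ^ (j mod n) = z ^ j"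
    using assms(1) by (intro power_eq_power_cong[of z n]) (auto simp: primitive_root_of_unity_def cong_def)
  hence "\<not> 0 < j mod n"
    using assms by (auto simp: primitive_root_of_unity_def)
  thus ?thesis by auto
qed

lemma primitive_root_power_inj:
  assumes "primitive_root_of_unity n z" "n > 0" "z ^ i = z ^ j" "i < n" "j < n"
  shows "i = j"
proof -
  have *: "i = j" if "z ^ i = z ^ j" "i \<le> j" "j < n" for i j
  proof -
    have "z \<noteq> 0" using assms(1,2) by (auto simp: primitive_root_of_unity_def power_0_left)
    hence "z ^ (j - i) = 1" using that by (simp add: power_diff)
    from primitive_root_power_eq_1D[OF assms(1,2) this] have "\<not> 0 < j - i"
      using that(3) by (auto dest: dvd_imp_le)
    thus ?thesis using that(2) by simp
  qed
  show ?thesis using *[of i j] *[of j i] assms by (cases "i \<le> j") auto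
qed

lemma sum_powers_root_of_unity:
  fixes z :: complex
  assumes "z ^ n = 1" "z \<noteq> 1"
  shows "(\<Sum>k<n. z ^ k) = 0"
  using geometric_sum[OF assms(2), of n] assms(1) by simp

lemma primitive_root_power_coprime:
  assumes "primitive_root_of_unity n z" "n > 0" "coprime t n"
  shows "primitive_root_of_unity n (z ^ t)"
  unfolding primitive_root_of_unity_def
proof (intro conjI allI impI)
  show "(z ^ t) ^ n = 1"
    using assms(1) by (metis mult.commute power_mult power_one primitive_root_of_unity_def)
  fix k assume k: "0 < k \<and> k < n"
  show "(z ^ t) ^ k \<noteq> 1"
  proof
    assume "(z ^ t) ^ k = 1"
    hence "n dvd t * k"
      using primitive_root_power_eq_1D[OF assms(1,2), of "t * k"] by (simp add: power_mult)
    hence "n dvd k" using assms(3) by (simp add: coprime_dvd_mult_right_iff coprime_commute)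
    with k show False by (auto dest: dvd_imp_le)
  qed
qed

text \<open>The case \<open>j = 1\<close> is the centre of gravity of a regular \<open>r\<close>-gon; all \<open>j\<close> together are the
orthogonality relations for the \<open>r\<close>-th root of unity \<open>z^(n div r)\<close>.\<close>

lemma sum_regular_polygon:
  assumes prim: "primitive_root_of_unity n z" and n: "n > 0" and r: "r dvd n" and j: "0 < j" "j < r"
  shows "(\<Sum>k<r. z ^ ((n div r) * j * k)) = 0"
proof -
  have nr: "n = (n div r) * r" using r by simp
  have "(\<Sum>k<r. (z ^ ((n div r) * j)) ^ k) = 0"
  proof (rule sum_powers_root_of_unity)
    have "(z ^ ((n div r) * j)) ^ r = (z ^ n) ^ j"
      by (subst (2) nr) (simp only: power_mult[symmetric] mult_ac)
    thus "(z ^ ((n div r) * j)) ^ r = 1" using prim by (simp add: primitive_root_of_unity_def)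
    show "z ^ ((n div r) * j) \<noteq> 1"
    proof
      assume "z ^ ((n div r) * j) = 1"
      from primitive_root_power_eq_1D[OF prim n this] have "(n div r) * r dvd (n div r) * j"
        using nr by simp
      moreover have "n div r \<noteq> 0" using n nr by (metis mult_zero_left not_gr_zero)
      ultimately have "r dvd j" by simp
      with j show False by (auto dest: dvd_imp_le)
    qed
  qed
  thus ?thesis by (simp add: power_mult)
qed

lemma root_of_unity_orthogonality:
  fixes z :: complex
  assumes prim: "primitive_root_of_unity n z" and i: "i < n" and j: "j < n"
  shows "(\<Sum>k<n. inverse z ^ (k * i) * z ^ (k * j)) = (if j = i then of_nat n else 0)"
proof -
  have zn: "z ^ n = 1" using prim by (simp add: primitive_root_of_unity_def)
  have n: "n > 0" using i by simp
  have z0: "z \<noteq> 0" using zn n by (auto simp: power_0_left)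
  have "(\<Sum>k<n. inverse z ^ (k * i) * z ^ (k * j)) = (\<Sum>k<n. (inverse z ^ i * z ^ j) ^ k)"
    by (simp add: power_mult_distrib mult.commute flip: power_mult)
  also have "\<dots> = (if j = i then of_nat n else 0)"
  proof (cases "j = i")
    case True
    thus ?thesis using z0 by (simp add: power_inverse)
  next
    case False
    have "(inverse z ^ i * z ^ j) ^ n = (inverse z ^ n) ^ i * (z ^ n) ^ j"
      by (simp add: power_mult_distrib mult.commute flip: power_mult)
    hence "(inverse z ^ i * z ^ j) ^ n = 1" by (simp add: zn power_inverse)
    moreover have "inverse z ^ i * z ^ j \<noteq> 1"
    proof
      assume "inverse z ^ i * z ^ j = 1"
      hence "z ^ j = z ^ i" using z0 by (simp add: power_inverse field_simps)
      with False primitive_root_power_inj[OF prim n _ j i] show False by blast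
    qed
    ultimately show ?thesis using False sum_powers_root_of_unity by simp
  qed
  finally show ?thesis .
qed

lemma fourier_inversion:
  fixes a :: "nat \<Rightarrow> complex"
  assumes prim: "primitive_root_of_unity n z" and i: "i < n"
  shows "(\<Sum>k<n. inverse z ^ (k * i) * (\<Sum>j<n. a j * z ^ (k * j))) = of_nat n * a i"
proof -
  have "(\<Sum>k<n. inverse z ^ (k * i) * (\<Sum>j<n. a j * z ^ (k * j))) =
        (\<Sum>k<n. \<Sum>j<n. a j * (inverse z ^ (k * i) * z ^ (k * j)))"
    by (simp add: sum_distrib_left mult_ac)
  also have "\<dots> = (\<Sum>j<n. a j * (\<Sum>k<n. inverse z ^ (k * i) * z ^ (k * j)))"
    by (subst sum.swap) (simp add: sum_distrib_left)
  also have "\<dots> = (\<Sum>j<n. if j = i then of_nat n * a i else 0)"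
    by (intro sum.cong) (auto simp: root_of_unity_orthogonality[OF prim i])
  also have "\<dots> = of_nat n * a i" using i by simp
  finally show ?thesis .
qed

lemma cong_multiple_of_cofactor:
  fixes i j k n r :: nat
  assumes "[j = i] (mod n div r)" "r dvd n" "r dvd k"
  shows "[k * j = k * i] (mod n)"
proof -
  obtain k' where k': "k = r * k'" using assms(3) by blast
  have "r * j mod (r * (n div r)) = r * i mod (r * (n div r))"
    using assms(1) unfolding cong_def by (simp add: mult_mod_right[symmetric])
  hence "[r * j = r * i] (mod n)" using assms(2) by (simp add: cong_def)
  from cong_mult[OF cong_refl[of k'] this] show ?thesis by (simp add: k' mult_ac)
qed

text \<open>Up to the factor \<open>n\<close>, Fourier inversion expresses \<open>a i + a j3 - a j1 - a j2\<close> as the sum over \<open>k\<close> of the transform of \<open>a\<close> at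
\<open>k\<close> times a factor that splits as \<open>y^(k i) (1 - y^(k (j1 - i))) (1 - y^(k (j2 - i)))\<close> with
\<open>y = z^(-1)\<close>. The transform is 0 when \<open>k\<close> is coprime to \<open>n\<close>; otherwise \<open>p\<close> or \<open>q\<close> divides \<open>k\<close>
and kills one of the brackets.\<close>

lemma vanishing_sum_parallelogram:
  fixes a :: "nat \<Rightarrow> nat"
  assumes prim: "primitive_root_of_unity n z" and n: "n > 0" and pq: "prime_factors n = {p, q}"
    and zero: "(\<Sum>i<n. of_nat (a i) * z ^ i) = 0"
    and lt: "i < n" "j1 < n" "j2 < n" "j3 < n"
    and j1: "[j1 = i] (mod n div p)" and j2: "[j2 = i] (mod n div q)"
    and j3: "[i + j3 = j1 + j2] (mod n)"
  shows "a i + a j3 = a j1 + a j2"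
proof -
  define A where "A = (\<lambda>k. \<Sum>j<n. of_nat (a j) * z ^ (k * j))"
  define y where "y = inverse z"
  have zn: "z ^ n = 1" using prim by (simp add: primitive_root_of_unity_def)
  hence yn: "y ^ n = 1" by (simp add: y_def power_inverse)
  have y0: "y \<noteq> 0" using yn n by (auto simp: power_0_left)
  have inv: "of_nat n * of_nat (a i) = (\<Sum>k<n. y ^ (k * i) * A k)" if "i < n" for i
    unfolding A_def y_def using fourier_inversion[OF prim that, of "\<lambda>j. of_nat (a j)"] by simp
  have vanish: "(y ^ (k * i) + y ^ (k * j3) - y ^ (k * j1) - y ^ (k * j2)) * A k = 0" for k
  proof (cases "coprime k n")
    case True
    thus ?thesis using vanishing_sum_galois_conjugate[OF zn n zero True] by (simp add: A_def)
  next
    case False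
    hence "gcd k n \<noteq> 1" using coprime_iff_gcd_eq_1[of k n] by argo
    from prime_factor_nat[OF this] obtain r where r: "prime r" and "r dvd gcd k n" by (elim exE conjE)
    hence "r dvd k" "r dvd n" by (meson dvd_trans gcd_dvd1, meson dvd_trans gcd_dvd2)
    note r = r this
    have "r \<in> prime_factors n" using r n by (intro prime_factorsI) auto
    hence "r = p \<or> r = q" unfolding pq by simp
    have "[k * i + k * j3 = k * j1 + k * j2] (mod n)"
      using cong_mult[OF cong_refl[of k] j3] by (simp add: ring_distribs)
    hence prod: "y ^ (k * i) * y ^ (k * j3) = y ^ (k * j1) * y ^ (k * j2)"
      unfolding power_add[symmetric] by (rule power_eq_power_cong[OF yn])
    from \<open>r = p \<or> r = q\<close> show ?thesis
    proof
      assume "r = p"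
      hence *: "y ^ (k * j1) = y ^ (k * i)"
        using cong_multiple_of_cofactor[OF j1] r by (intro power_eq_power_cong[OF yn]) simp
      from prod have "y ^ (k * i) * y ^ (k * j3) = y ^ (k * i) * y ^ (k * j2)"
        unfolding * by (simp only: mult.commute)
      hence "y ^ (k * j3) = y ^ (k * j2)" using y0 by (metis mult_left_cancel power_not_zero)
      thus ?thesis unfolding * by simp
    next
      assume "r = q"
      hence *: "y ^ (k * j2) = y ^ (k * i)"
        using cong_multiple_of_cofactor[OF j2] r by (intro power_eq_power_cong[OF yn]) simp
      from prod have "y ^ (k * i) * y ^ (k * j3) = y ^ (k * i) * y ^ (k * j1)"
        unfolding * by (simp only: mult.commute)
      hence "y ^ (k * j3) = y ^ (k * j1)" using y0 by (metis mult_left_cancel power_not_zero)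
      thus ?thesis unfolding * by simp
    qed
  qed
  have "of_nat n * (of_nat (a i) + of_nat (a j3) - of_nat (a j1) - of_nat (a j2) :: complex) =
      (\<Sum>k<n. (y ^ (k * i) + y ^ (k * j3) - y ^ (k * j1) - y ^ (k * j2)) * A k)"
    by (simp add: ring_distribs sum.distrib sum_subtractf inv lt)
  also have "\<dots> = 0" by (simp add: vanish)
  finally have "of_nat (a i) + of_nat (a j3) - of_nat (a j1) - of_nat (a j2) = (0 :: complex)"
    using n by simp
  hence "of_nat (a i + a j3) = (of_nat (a j1 + a j2) :: complex)"
    by (simp add: algebra_simps)
  thus ?thesis by (simp only: of_nat_eq_iff)
qed

text \<open>The polygon through \<open>i\<close> is written from its least vertex \<open>h = i mod (n div r)\<close>, so that all vertices
\<open>h + k (n div r)\<close> with \<open>k < r\<close> are smaller than \<open>n\<close>. The case \<open>p = q\<close> is allowed.\<close>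

lemma vanishing_sum_contains_polygon:
  fixes a :: "nat \<Rightarrow> nat"
  assumes prim: "primitive_root_of_unity n z" and n: "n > 0" and pq: "prime_factors n = {p, q}"
    and zero: "(\<Sum>i<n. of_nat (a i) * z ^ i) = 0" and i: "i < n" "a i > 0"
  shows "\<exists>r\<in>{p, q}. \<exists>h < n div r. \<forall>k<r. a (h + k * (n div r)) > 0"
proof (rule ccontr)
  assume neg: "\<not> ?thesis"
  have gap: "\<exists>j<n. [j = i] (mod n div r) \<and> a j = 0" if "r \<in> {p, q}" for r
  proof -
    have "r \<in> prime_factors n" using that pq by simp
    hence "r dvd n" "r > 0" by (auto simp: in_prime_factors_iff prime_gt_0_nat)
    hence nr: "n = r * (n div r)" "n div r > 0" using n by (auto simp: div_greater_zero_iff dvd_imp_le)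
    define h where "h = i mod (n div r)"
    have h: "h < n div r" using nr by (simp add: h_def)
    with neg that have "\<not> (\<forall>k<r. a (h + k * (n div r)) > 0)" by blast
    then obtain k where k: "k < r" "a (h + k * (n div r)) = 0" by auto
    have "h + k * (n div r) < Suc k * (n div r)" using h by simp
    also have "\<dots> \<le> r * (n div r)" using k(1) by (intro mult_le_mono1) simp
    finally have "h + k * (n div r) < n" using nr(1) by simp
    thus ?thesis using k(2) by (intro exI[of _ "h + k * (n div r)"]) (auto simp: cong_def h_def)
  qed
  obtain j1 where j1: "j1 < n" "[j1 = i] (mod n div p)" "a j1 = 0" using gap[of p] by auto
  obtain j2 where j2: "j2 < n" "[j2 = i] (mod n div q)" "a j2 = 0" using gap[of q] by auto
  (* The fourth vertex of the parallelogram spanned by the zeros j1 and j2 at i. *)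
  define j3 where "j3 = (j1 + j2 + (n - i)) mod n"
  have "[i + j3 = i + (j1 + j2 + (n - i))] (mod n)"
    unfolding j3_def by (intro cong_add) (auto simp: cong_def)
  moreover have "i + (j1 + j2 + (n - i)) = j1 + j2 + n" using i by simp
  ultimately have "[i + j3 = j1 + j2] (mod n)" by (simp add: cong_def)
  from vanishing_sum_parallelogram[OF prim n pq zero i(1) j1(1) j2(1) _ j1(2) j2(2) this]
  have "a i + a j3 = a j1 + a j2" using n by (simp add: j3_def)
  with i(2) j1(3) j2(3) show False by simp
qed

section \<open>Circulant determinants\<close>

text \<open>The matrix \<open>G\<close> of powers of \<open>w\<close> diagonalises every circulant matrix \<open>C\<close> from the left:
\<open>G C = E G\<close>, where \<open>E\<close> is the diagonal matrix of the sums on the right-hand side. Over a ring that need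
not be a domain, \<open>det G\<close> can be cancelled because \<open>F G\<close> is \<open>p\<close> times the identity and \<open>p\<close> is a
unit.\<close>

lemma circulant_det_eq_prod:
  fixes u :: "nat \<Rightarrow> 'a :: comm_ring_1" and w c :: 'a
  assumes p: "p > 0" and w: "w ^ p = 1"
    and orth: "\<And>j. 0 < j \<Longrightarrow> j < p \<Longrightarrow> (\<Sum>k<p. w ^ (k * j)) = 0" and unit: "c * of_nat p = 1"
  shows "circulant_det p u = (\<Prod>k<p. \<Sum>j<p. w ^ (k * j) * u j)"
proof -
  define ev where "ev = (\<lambda>k. \<Sum>j<p. w ^ (k * j) * u j)"
  define C where "C = mat p p (\<lambda>(r, s). u ((r + p - s) mod p))"
  define G where "G = mat p p (\<lambda>(k, r). w ^ (k * r))"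
  define F where "F = mat p p (\<lambda>(r, k). w ^ (k * (p - r)))"
  define E where "E = mat p p (\<lambda>(k, l). if k = l then ev k else 0)"
  have carr: "C \<in> carrier_mat p p" "G \<in> carrier_mat p p" "F \<in> carrier_mat p p" "E \<in> carrier_mat p p"
    by (auto simp: C_def G_def F_def E_def)
  have GC: "G * C = E * G"
  proof (rule eq_matI)
    fix k s assume ks: "k < dim_row (E * G)" "s < dim_col (E * G)"
    hence k: "k < p" and s: "s < p" using carr by auto
    have "(G * C) $$ (k, s) = (\<Sum>r<p. w ^ (k * r) * u ((r + p - s) mod p))"
      using k s by (simp add: G_def C_def scalar_prod_def atLeast0LessThan)
    also have "\<dots> = (\<Sum>t<p. w ^ (k * t) * u t * w ^ (k * s))"
    proof (rule sum.reindex_bij_witness[of _ "\<lambda>t. (t + s) mod p" "\<lambda>r. (r + p - s) mod p"])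
      fix r assume r: "r \<in> {..<p}"
      show inv: "((r + p - s) mod p + s) mod p = r"
        using r s by (simp add: mod_add_left_eq)
      have "[k * ((r + p - s) mod p) + k * s = k * r] (mod p)"
        using inv cong_mult[OF cong_refl[of k], of "(r + p - s) mod p + s" r p] r
        by (simp add: cong_def ring_distribs)
      hence "w ^ (k * ((r + p - s) mod p)) * w ^ (k * s) = w ^ (k * r)"
        unfolding power_add[symmetric] by (rule power_eq_power_cong[OF w])
      thus "w ^ (k * ((r + p - s) mod p)) * u ((r + p - s) mod p) * w ^ (k * s) =
          w ^ (k * r) * u ((r + p - s) mod p)"
        by (metis mult.assoc mult.commute)
    next
      fix t assume t: "t \<in> {..<p}"
      have "((t + s) mod p + p - s) mod p = ((t + s) mod p + (p - s)) mod p" using s by simp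
      also have "\<dots> = (t + s + (p - s)) mod p" by (rule mod_add_left_eq)
      also have "\<dots> = t" using s t by simp
      finally show "((t + s) mod p + p - s) mod p = t" .
    qed (use p in auto)
    also have "\<dots> = ev k * w ^ (k * s)" by (simp add: ev_def sum_distrib_right)
    also have "\<dots> = (\<Sum>l<p. if l = k then ev k * w ^ (k * s) else 0)" using k by simp
    also have "\<dots> = (\<Sum>l<p. (if k = l then ev k else 0) * w ^ (l * s))"
      by (intro sum.cong) auto
    also have "\<dots> = (E * G) $$ (k, s)"
      using k s by (simp add: G_def E_def scalar_prod_def atLeast0LessThan)
    finally show "(G * C) $$ (k, s) = (E * G) $$ (k, s)" .
  qed (use carr in auto)
  have FG: "F * G = of_nat p \<cdot>\<^sub>m 1\<^sub>m p"
  proof (rule eq_matI)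
    fix r s assume rs: "r < dim_row (of_nat p \<cdot>\<^sub>m 1\<^sub>m p)" "s < dim_col (of_nat p \<cdot>\<^sub>m 1\<^sub>m p)"
    hence r: "r < p" and s: "s < p" by auto
    have "(F * G) $$ (r, s) = (\<Sum>k<p. w ^ (k * (p - r)) * w ^ (k * s))"
      using r s by (simp add: G_def F_def scalar_prod_def atLeast0LessThan)
    also have "\<dots> = (\<Sum>k<p. w ^ (k * ((p - r + s) mod p)))"
      unfolding power_add[symmetric] distrib_left[symmetric]
      by (intro sum.cong refl power_eq_power_cong[OF w] cong_mult) (auto simp: cong_def)
    also have "\<dots> = (if r = s then of_nat p else 0)"
    proof (cases "r = s")
      case True
      thus ?thesis using r by simp
    next
      case False
      have "(p - r + s) mod p \<noteq> 0"
      proof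
        assume "(p - r + s) mod p = 0"
        hence "[p - r + s + r = 0 + r] (mod p)" by (intro cong_add) (auto simp: cong_def)
        hence "s = r" using r s by (simp add: cong_def)
        with False show False by simp
      qed
      thus ?thesis using False p by (simp add: orth)
    qed
    finally show "(F * G) $$ (r, s) = (of_nat p \<cdot>\<^sub>m 1\<^sub>m p) $$ (r, s)" using r s by simp
  qed (use carr in auto)
  have "det F * det G = of_nat p ^ p"
    using det_mult[OF carr(3,2)] FG by simp
  hence u1: "c ^ p * det F * det G = 1"
    using unit by (simp add: mult.assoc flip: power_mult_distrib)
  have "det E = prod_list (diag_mat E)"
    by (rule det_upper_triangular[OF _ carr(4)]) (auto simp: E_def)
  also have "\<dots> = (\<Prod>k<p. ev k)"
    by (simp add: diag_mat_def E_def prod.distinct_set_conv_list[symmetric] atLeast0LessThan cong: map_cong)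
  finally have E: "det E = (\<Prod>k<p. ev k)" .
  have "det G * det C = det E * det G"
    using GC det_mult[OF carr(2,1)] det_mult[OF carr(4,2)] by simp
  hence "(c ^ p * det F * det G) * det C = (c ^ p * det F * det G) * det E"
    by (metis mult.assoc mult.commute)
  hence "det C = det E" by (simp add: u1)
  thus ?thesis by (simp add: E circulant_det_def C_def ev_def)
qed

section \<open>Derivations that shift the variables\<close>

lemma Const_0 [simp]: "Const 0 = 0" by (simp add: Const_def)
lemma Const_1 [simp]: "Const 1 = 1" by (simp add: Const_def)
lemma Const_add: "Const (a + b) = Const a + Const b" by (simp add: Const_def single_add)
lemma Const_mult: "Const (a * b) = Const a * Const b" by (simp add: Const_def mult_single)
lemma Const_sum: "Const (sum f S) = (\<Sum>s\<in>S. Const (f s))"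
  by (induction S rule: infinite_finite_induct) (auto simp: Const_add)
lemma Const_power: "Const (a ^ k) = Const a ^ k" by (induction k) (auto simp: Const_mult)
lemma Const_of_nat: "Const (of_nat k) = of_nat k" by (induction k) (auto simp: Const_add)

lemma poly_mapping_sum_singles:
  "f = (\<Sum>m\<in>Poly_Mapping.keys f. Poly_Mapping.single m (Poly_Mapping.lookup f m))"
  by (rule poly_mapping_eqI)
     (auto simp: lookup_sum lookup_single when_def in_keys_iff sum.If_cases sum.delta)

lemma partial_superset:
  assumes "finite S" "Poly_Mapping.keys f \<subseteq> S"
  shows "partial i f = (\<Sum>m\<in>S. Poly_Mapping.single (m - Poly_Mapping.single i 1)
       (of_nat (Poly_Mapping.lookup m i) * Poly_Mapping.lookup f m))"
  unfolding partial_def using assms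
  by (intro sum.mono_neutral_left) (auto simp: in_keys_iff)

lemma partial_add: "partial i (f + g) = partial i f + partial i g"
proof -
  let ?S = "Poly_Mapping.keys f \<union> Poly_Mapping.keys g"
  have "Poly_Mapping.keys (f + g) \<subseteq> ?S" by (rule keys_add)
  thus ?thesis
    by (simp add: partial_superset[of ?S] lookup_add ring_distribs single_add sum.distrib)
qed

lemma partial_0 [simp]: "partial i 0 = 0" by (simp add: partial_def)

lemma partial_sum: "partial i (sum f S) = (\<Sum>s\<in>S. partial i (f s))"
  by (induction S rule: infinite_finite_induct) (auto simp: partial_add)

lemma partial_single:
  "partial i (Poly_Mapping.single m c) =
     Poly_Mapping.single (m - Poly_Mapping.single i 1) (of_nat (Poly_Mapping.lookup m i) * c)"
  by (simp add: partial_def)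

text \<open>Where the exponent of the \<open>i\<close>-th variable is 0 the truncated difference of exponents is wrong, but it
then comes with the coefficient 0.\<close>

lemma partial_mult_single:
  "partial i (Poly_Mapping.single m c * Poly_Mapping.single m' c') =
     partial i (Poly_Mapping.single m c) * Poly_Mapping.single m' c' +
     Poly_Mapping.single m c * partial i (Poly_Mapping.single m' c')"
proof -
  let ?e = "Poly_Mapping.single i (1 :: nat)"
  have left: "Poly_Mapping.single (m - ?e + m') (of_nat (Poly_Mapping.lookup m i) * c * c') =
      Poly_Mapping.single (m + m' - ?e) (of_nat (Poly_Mapping.lookup m i) * c * c')"
  for m m' :: "nat \<Rightarrow>\<^sub>0 nat" and c c' :: complex
  proof (cases "Poly_Mapping.lookup m i = 0")
    case False
    hence "m - ?e + m' = m + m' - ?e"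
      by (intro poly_mapping_eqI) (auto simp: lookup_add lookup_minus lookup_single when_def)
    thus ?thesis by simp
  qed simp
  show ?thesis
    using left[of m m' c c'] left[of m' m c' c]
    by (simp add: mult_single partial_single lookup_add single_add[symmetric] ring_distribs add_ac mult_ac)
qed

lemma partial_mult: "partial i (f * g) = partial i f * g + f * partial i g"
proof -
  let ?f = "\<lambda>m. Poly_Mapping.single m (Poly_Mapping.lookup f m)"
  let ?g = "\<lambda>m. Poly_Mapping.single m (Poly_Mapping.lookup g m)"
  have f: "f = sum ?f (Poly_Mapping.keys f)" and g: "g = sum ?g (Poly_Mapping.keys g)"
    by (rule poly_mapping_sum_singles)+
  have "partial i (sum ?f S * sum ?g T) = partial i (sum ?f S) * sum ?g T + sum ?f S * partial i (sum ?g T)" for S T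
    by (simp only: sum_product partial_sum partial_mult_single sum.distrib)
  from this[of "Poly_Mapping.keys f" "Poly_Mapping.keys g"] show ?thesis
    by (simp only: f[symmetric] g[symmetric])
qed

lemma partial_Const [simp]: "partial i (Const c) = 0"
  by (simp add: Const_def partial_single)

lemma partial_X: "partial i (X j) = (if i = j then 1 else 0)"
  by (simp add: X_def partial_single lookup_single when_def)

text \<open>The two operators of the theorem differ only in the direction of the shift: \<open>s = n - 1\<close> gives \<open>D\<close> and
\<open>s = 1\<close> gives \<open>\<Delta>\<close>.\<close>

definition shift_derivation :: "nat \<Rightarrow> nat \<Rightarrow> cpoly \<Rightarrow> cpoly" where
  "shift_derivation n s f = (\<Sum>i<n. X ((i + s) mod n) * partial i f)"

lemma D_op_eq_shift_derivation: "n > 0 \<Longrightarrow> D_op n = shift_derivation n (n - 1)"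
  by (auto simp: D_op_def shift_derivation_def)

lemma Delta_op_eq_shift_derivation: "Delta_op n = shift_derivation n 1"
  by (auto simp: Delta_op_def shift_derivation_def)

lemma shift_derivation_add:
  "shift_derivation n s (f + g) = shift_derivation n s f + shift_derivation n s g"
  by (simp add: shift_derivation_def partial_add ring_distribs sum.distrib)

lemma shift_derivation_mult:
  "shift_derivation n s (f * g) = shift_derivation n s f * g + f * shift_derivation n s g"
  by (simp add: shift_derivation_def partial_mult ring_distribs sum.distrib sum_distrib_left sum_distrib_right mult_ac)

lemma shift_derivation_Const [simp]: "shift_derivation n s (Const c) = 0"
  by (simp add: shift_derivation_def)

lemma shift_derivation_0 [simp]: "shift_derivation n s 0 = 0"
  by (simp add: shift_derivation_def)

lemma shift_derivation_sum: "shift_derivation n s (sum f S) = (\<Sum>x\<in>S. shift_derivation n s (f x))"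
  by (induction S rule: infinite_finite_induct) (auto simp: shift_derivation_add)

lemma shift_derivation_X: "j < n \<Longrightarrow> shift_derivation n s (X j) = X ((j + s) mod n)"
  by (simp add: shift_derivation_def partial_X if_distrib cong: if_cong)

lemma shift_derivation_prod_eigen:
  assumes "finite I" "\<And>i. i \<in> I \<Longrightarrow> shift_derivation n s (g i) = Const (w i) * g i"
  shows "shift_derivation n s (prod g I) = Const (sum w I) * prod g I"
  using assms
proof (induction I rule: finite_induct)
  case empty
  show ?case using shift_derivation_Const[of n s 1] by simp
next
  case (insert i I)
  thus ?case by (simp add: shift_derivation_mult Const_add algebra_simps)
qed

lemma shift_derivation_power_eigen:
  assumes "shift_derivation n s g = Const w * g"
  shows "shift_derivation n s (g ^ k) = Const (of_nat k * w) * g ^ k"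
  using shift_derivation_prod_eigen[of "{..<k}" n s "\<lambda>_. g" "\<lambda>_. w"] assms by simp

section \<open>Fourier variables\<close>

definition fourier_var :: "nat \<Rightarrow> complex \<Rightarrow> nat \<Rightarrow> cpoly" where
  "fourier_var n z m = (\<Sum>j<n. Const (z ^ (m * j)) * X j)"

text \<open>Shifting the summation index by \<open>s\<close> multiplies by \<open>z^(- s m)\<close>, and \<open>z^(t m)\<close> with \<open>s + t = n\<close>
is the same number with a natural exponent.\<close>

lemma shift_derivation_fourier_var:
  assumes z: "z ^ n = 1" and st: "s + t = n"
  shows "shift_derivation n s (fourier_var n z m) = Const (z ^ (t * m)) * fourier_var n z m"
proof -
  have "shift_derivation n s (fourier_var n z m) = (\<Sum>j<n. Const (z ^ (m * j)) * X ((j + s) mod n))"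
    by (simp add: fourier_var_def shift_derivation_sum shift_derivation_mult shift_derivation_X)
  also have "\<dots> = (\<Sum>k<n. Const (z ^ (t * m)) * (Const (z ^ (m * k)) * X k))"
  proof (rule sum.reindex_bij_witness[of _ "\<lambda>k. (k + t) mod n" "\<lambda>j. (j + s) mod n"])
    fix j assume j: "j \<in> {..<n}"
    have "((j + s) mod n + t) mod n = (j + s + t) mod n" by (rule mod_add_left_eq)
    also have "\<dots> = j" using j st by (simp add: add.assoc)
    finally show inv: "((j + s) mod n + t) mod n = j" .
    have "[t * m + m * ((j + s) mod n) = m * j] (mod n)"
      using inv cong_mult[OF cong_refl[of m], of "(j + s) mod n + t" j n] j
      by (simp add: cong_def ring_distribs mult_ac add_ac)
    hence "z ^ (t * m) * z ^ (m * ((j + s) mod n)) = z ^ (m * j)"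
      unfolding power_add[symmetric] by (rule power_eq_power_cong[OF z])
    thus "Const (z ^ (t * m)) * (Const (z ^ (m * ((j + s) mod n))) * X ((j + s) mod n)) =
        Const (z ^ (m * j)) * X ((j + s) mod n)"
      by (simp add: mult.assoc[symmetric] Const_mult[symmetric])
  next
    fix k assume k: "k \<in> {..<n}"
    have "((k + t) mod n + s) mod n = (k + t + s) mod n" by (rule mod_add_left_eq)
    also have "\<dots> = k" using k st by (simp add: add.assoc add.commute[of t])
    finally show "((k + t) mod n + s) mod n = k" .
  qed auto
  finally show ?thesis by (simp add: fourier_var_def sum_distrib_left)
qed

text \<open>With \<open>w = z^(n/p)\<close>, the \<open>k\<close>-th eigenvalue of the circulant matrix of \<open>y\<^sub>i\<close> weights \<open>x\<^bsub>j + p l\<^esub>\<close> with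
\<open>w^(k j) z^(i (j + p l))\<close>. Since \<open>w^p = 1\<close>, the exponent \<open>j\<close> of \<open>w^k\<close> may be replaced by \<open>j + p l\<close>, and the
double sum over \<open>j\<close> and \<open>l\<close> becomes a single Fourier variable.\<close>

lemma Theta_eq_prod:
  assumes prim: "primitive_root_of_unity n z" and n: "n > 0" and p: "p dvd n"
  shows "Theta n z p i = (\<Prod>k<p. fourier_var n z (i + k * (n div p)))"
proof -
  have p0: "p > 0" using p n by (auto intro: Nat.gr0I)
  have nr: "n = (n div p) * p" using p by simp
  have zn: "z ^ n = 1" using prim by (simp add: primitive_root_of_unity_def)
  define w where "w = Const (z ^ (n div p))"
  have wpow: "w ^ k = Const (z ^ ((n div p) * k))" for k
    by (simp add: w_def Const_power[symmetric] power_mult)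
  have "Theta n z p i = (\<Prod>k<p. \<Sum>j<p. w ^ (k * j) * yvar n z p i j)"
    unfolding Theta_def
  proof (rule circulant_det_eq_prod[OF p0])
    show "w ^ p = 1" using nr zn by (simp add: wpow)
    show "Const (inverse (of_nat p)) * of_nat p = 1"
      using p0 by (simp add: Const_mult[symmetric] flip: Const_of_nat)
    show "(\<Sum>k<p. w ^ (k * j)) = 0" if "0 < j" "j < p" for j
      using sum_regular_polygon[OF prim n p that]
      by (simp add: wpow Const_sum[symmetric] mult_ac)
  qed
  also have "\<dots> = (\<Prod>k<p. fourier_var n z (i + k * (n div p)))"
  proof (rule prod.cong)
    fix k
    let ?g = "\<lambda>m. Const (z ^ ((i + k * (n div p)) * m)) * X m"
    have *: "w ^ (k * j) * Const (z ^ (i * (j + p * l))) = Const (z ^ ((i + k * (n div p)) * (j + p * l)))" for j l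
    proof -
      have "(n div p) * (k * j) + i * (j + p * l) + n * (k * l) =
          (n div p) * (k * j) + i * (j + p * l) + ((n div p) * p) * (k * l)"
        using nr by simp
      also have "\<dots> = (i + k * (n div p)) * (j + p * l)" by (simp add: algebra_simps)
      finally have e: "(n div p) * (k * j) + i * (j + p * l) + n * (k * l) = (i + k * (n div p)) * (j + p * l)" .
      have "[(n div p) * (k * j) + i * (j + p * l) = (i + k * (n div p)) * (j + p * l)] (mod n)"
        unfolding e[symmetric] by (simp add: cong_def)
      hence "z ^ ((n div p) * (k * j) + i * (j + p * l)) = z ^ ((i + k * (n div p)) * (j + p * l))"
        by (rule power_eq_power_cong[OF zn])
      thus ?thesis by (simp only: wpow Const_mult[symmetric] power_add[symmetric])
    qed
    have "(\<Sum>j<p. w ^ (k * j) * yvar n z p i j) = (\<Sum>j<p. \<Sum>l<n div p. ?g (j + p * l))"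
      by (simp add: yvar_def sum_distrib_left mult.assoc[symmetric] *)
    also have "\<dots> = (\<Sum>(j, l)\<in>{..<p} \<times> {..<n div p}. ?g (j + p * l))"
      by (simp add: sum.cartesian_product)
    also have "\<dots> = (\<Sum>m<n. ?g m)"
    proof (rule sum.reindex_bij_witness[of _ "\<lambda>m. (m mod p, m div p)" "\<lambda>(j, l). j + p * l"], goal_cases)
      case (2 x)
      have "j + p * l < n" if "j < p" "l < n div p" for j l
      proof -
        have "j + p * l < p * Suc l" using that by simp
        also have "\<dots> \<le> p * (n div p)" using that(2) by (intro mult_le_mono2) simp
        finally show ?thesis using p by simp
      qed
      thus ?case using 2 by auto
    next
      case (4 m)
      thus ?case using p0 p by (auto simp: less_mult_imp_div_less)
    qed (use p0 in auto)
    finally show "(\<Sum>j<p. w ^ (k * j) * yvar n z p i j) = fourier_var n z (i + k * (n div p))"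
      by (simp add: fourier_var_def)
  qed simp
  finally show ?thesis .
qed

lemma X_eq_sum_fourier_var:
  assumes prim: "primitive_root_of_unity n z" and j: "j < n"
  shows "X j = (\<Sum>k<n. Const (inverse (of_nat n) * inverse z ^ (k * j)) * fourier_var n z k)"
proof -
  have "(\<Sum>k<n. Const (inverse (of_nat n) * inverse z ^ (k * j)) * fourier_var n z k) =
      (\<Sum>k<n. \<Sum>l<n. Const (inverse (of_nat n) * (inverse z ^ (k * j) * z ^ (k * l))) * X l)"
    by (simp add: fourier_var_def sum_distrib_left mult.assoc[symmetric] Const_mult)
  also have "\<dots> = (\<Sum>l<n. Const (inverse (of_nat n) * (\<Sum>k<n. inverse z ^ (k * j) * z ^ (k * l))) * X l)"
    by (subst sum.swap) (simp add: sum_distrib_left sum_distrib_right Const_sum)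
  also have "\<dots> = (\<Sum>l<n. if l = j then X l else 0)"
    using j by (intro sum.cong) (auto simp: root_of_unity_orthogonality[OF prim j])
  also have "\<dots> = X j" using j by simp
  finally show ?thesis by simp
qed

section \<open>The kernel of a diagonalisable derivation\<close>

text \<open>Summands of nonzero weight are eliminated one at a time: the equation \<open>T f = 0\<close> expresses
\<open>c i *s b i\<close> with \<open>w i \<noteq> 0\<close> by the other summands, which changes their coefficients but introduces no
new vector.\<close>

lemma (in vector_space) kernel_of_diagonal_operator:
  assumes add: "\<And>x y. T (x + y) = T x + T y" and scale: "\<And>c x. T (c *s x) = c *s T x"
    and eigen: "\<And>i. i \<in> I \<Longrightarrow> T (b i) = w i *s b i"
    and f: "f \<in> span (b ` I)" "T f = 0"
  shows "f \<in> span (b ` {i \<in> I. w i = 0})"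
proof -
  have T0: "T 0 = 0" using add[of 0 0] by simp
  have Tsum: "T (\<Sum>i\<in>J. g i) = (\<Sum>i\<in>J. T (g i))" for g :: "'i \<Rightarrow> 'b" and J
    by (induction J rule: infinite_finite_induct) (auto simp: T0 add)
  have main: "(\<Sum>i\<in>J. c i *s b i) \<in> span (b ` {i \<in> I. w i = 0})"
    if "finite J" "J \<subseteq> I" "T (\<Sum>i\<in>J. c i *s b i) = 0" for J c
    using that
  proof (induction J arbitrary: c rule: finite_induct)
    case empty
    show ?case by (simp add: span_zero)
  next
    case (insert i J)
    let ?f = "\<Sum>j\<in>J. c j *s b j"
    have Tf: "T ?f = (\<Sum>j\<in>J. (c j * w j) *s b j)"
      using insert.prems(1) by (auto simp: Tsum scale eigen intro!: sum.cong)
    have i: "T (b i) = w i *s b i" using insert.prems(1) eigen by simp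
    have sum0: "(c i * w i) *s b i + T ?f = 0"
      using insert by (simp add: add scale i)
    show ?case
    proof (cases "w i = 0")
      case True
      hence "?f \<in> span (b ` {i \<in> I. w i = 0})" using insert sum0 by auto
      moreover have "c i *s b i \<in> span (b ` {i \<in> I. w i = 0})"
        using True insert.prems(1) by (intro span_scale span_base) auto
      ultimately show ?thesis using insert by (simp add: span_add)
    next
      case False
      (* The coefficients of f after T f = 0, divided by w i, has been used to remove b i. *)
      define d where "d = (\<lambda>j. c j - c j * w j / w i)"
      have "(c i * w i) *s b i = - T ?f" using sum0 by (simp add: eq_neg_iff_add_eq_0)
      hence "inverse (w i) *s ((c i * w i) *s b i) = inverse (w i) *s (- T ?f)" by simp
      moreover have "inverse (w i) * (c i * w i) = c i" using False by simp
      ultimately have "c i *s b i = - (inverse (w i) *s T ?f)" by simp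
      also have "inverse (w i) *s T ?f = (\<Sum>j\<in>J. (c j * w j / w i) *s b j)"
        unfolding Tf by (simp add: scale_sum_right field_simps)
      finally have eq: "(\<Sum>j\<in>insert i J. c j *s b j) = (\<Sum>j\<in>J. d j *s b j)"
        using insert by (simp add: d_def scale_left_diff_distrib sum_subtractf)
      thus ?thesis using insert.IH[of d] insert.prems by simp
    qed
  qed
  obtain S c where S: "finite S" "S \<subseteq> b ` I" "f = (\<Sum>v\<in>S. c v *s v)"
    using f(1) unfolding span_explicit by auto
  then obtain J where J: "J \<subseteq> I" "inj_on b J" "S = b ` J"
    by (meson subset_image_inj)
  have "finite J" using S(1) J finite_imageD by blast
  have "f = (\<Sum>i\<in>J. c (b i) *s b i)" using S(3) J by (simp add: sum.reindex)
  with main[OF \<open>finite J\<close> J(1)] f(2) show ?thesis by simp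
qed

interpretation cpoly: vector_space "\<lambda>c f. Const c * f"
  by unfold_locales (auto simp: algebra_simps Const_add Const_mult)

definition fourier_monom :: "nat \<Rightarrow> complex \<Rightarrow> (nat \<Rightarrow> nat) \<Rightarrow> cpoly" where
  "fourier_monom n z a = (\<Prod>i<n. fourier_var n z i ^ a i)"

lemma fourier_var_mult_fourier_monom:
  "k < n \<Longrightarrow> fourier_var n z k * fourier_monom n z a = fourier_monom n z (a(k := Suc (a k)))"
  by (simp add: fourier_monom_def prod.remove[of "{..<n}" k] mult_ac)

text \<open>By Fourier inversion \<open>X j\<close> is a linear combination of Fourier variables, and multiplying a
monomial by one of these raises an exponent.\<close>

lemma X_mult_span_fourier_monom:
  assumes prim: "primitive_root_of_unity n z" and j: "j < n" and f: "f \<in> cpoly.span (range (fourier_monom n z))"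
  shows "X j * f \<in> cpoly.span (range (fourier_monom n z))"
  using f
proof (induction rule: cpoly.span_induct_alt)
  case base
  show ?case by (simp add: cpoly.span_zero)
next
  case (step c x y)
  then obtain a where a: "x = fourier_monom n z a" by blast
  have "X j * x = (\<Sum>k<n. Const (inverse (of_nat n) * inverse z ^ (k * j)) * (fourier_var n z k * x))"
    by (subst X_eq_sum_fourier_var[OF prim j]) (simp add: sum_distrib_right mult.assoc)
  also have "\<dots> \<in> cpoly.span (range (fourier_monom n z))"
    unfolding a by (intro cpoly.span_sum cpoly.span_scale cpoly.span_base) (auto simp: fourier_var_mult_fourier_monom)
  finally have "Const c * (X j * x) + X j * y \<in> cpoly.span (range (fourier_monom n z))"
    using step by (intro cpoly.span_add cpoly.span_scale)
  thus ?case by (simp add: algebra_simps)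
qed

lemma X_power: "X i ^ k = Poly_Mapping.single (Poly_Mapping.single i k) 1"
  by (induction k) (auto simp: X_def mult_single simp flip: single_add)

lemma single_in_span_fourier_monom:
  assumes prim: "primitive_root_of_unity n z" and m: "Poly_Mapping.keys m \<subseteq> {..<n}"
  shows "Poly_Mapping.single m 1 \<in> cpoly.span (range (fourier_monom n z))"
  using m
proof (induction m rule: update_induct)
  case const
  have "fourier_monom n z (\<lambda>_. 0) = Poly_Mapping.single 0 1" by (simp add: fourier_monom_def)
  thus ?case by (metis cpoly.span_base rangeI)
next
  case (update m i k)
  have eq: "Poly_Mapping.update i k m = Poly_Mapping.single i k + m"
    using update by (intro poly_mapping_eqI) (auto simp: lookup_update lookup_add lookup_single when_def in_keys_iff)
  have "i < n" "Poly_Mapping.single m 1 \<in> cpoly.span (range (fourier_monom n z))"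
    using update by (auto simp: keys_update)
  hence "X i ^ l * Poly_Mapping.single m 1 \<in> cpoly.span (range (fourier_monom n z))" for l
    by (induction l) (auto simp: mult.assoc intro: X_mult_span_fourier_monom[OF prim])
  thus ?case by (simp add: eq X_power mult_single)
qed

lemma polyring_subset_span_fourier_monom:
  assumes prim: "primitive_root_of_unity n z"
  shows "polyring n \<subseteq> cpoly.span (range (fourier_monom n z))"
proof
  fix f assume f: "f \<in> polyring n"
  have single: "Poly_Mapping.single m c = Const c * Poly_Mapping.single m 1" for m c
    by (simp add: Const_def mult_single)
  have "(\<Sum>m\<in>Poly_Mapping.keys f. Poly_Mapping.single m (Poly_Mapping.lookup f m)) \<in> cpoly.span (range (fourier_monom n z))"
    using f by (subst single, intro cpoly.span_sum cpoly.span_scale single_in_span_fourier_monom[OF prim])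
      (auto simp: polyring_def)
  thus "f \<in> cpoly.span (range (fourier_monom n z))" by (simp flip: poly_mapping_sum_singles)
qed

lemma shift_derivation_fourier_monom:
  assumes z: "z ^ n = 1" and st: "s + t = n"
  shows "shift_derivation n s (fourier_monom n z a) = Const (\<Sum>i<n. of_nat (a i) * (z ^ t) ^ i) * fourier_monom n z a"
  unfolding fourier_monom_def
  by (rule shift_derivation_prod_eigen)
     (auto intro!: shift_derivation_power_eigen shift_derivation_fourier_var[OF z st] simp flip: power_mult)

section \<open>Monomials of weight zero\<close>

lemma subalgebra_mult: "subalgebra A \<Longrightarrow> f \<in> A \<Longrightarrow> g \<in> A \<Longrightarrow> f * g \<in> A"
  by (simp add: subalgebra_def)

lemma subalgebra_prod:
  assumes "subalgebra A" "\<And>i. i \<in> I \<Longrightarrow> g i \<in> A"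
  shows "prod g I \<in> A"
proof -
  have "1 \<in> A" using assms(1) by (metis Const_1 rangeI subalgebra_def subsetD)
  with assms show ?thesis
    by (induction I rule: infinite_finite_induct) (auto simp: subalgebra_def)
qed

lemma subalgebra_generated_algebra: "subalgebra (generated_algebra S)"
  unfolding generated_algebra_def by (rule hull_in) (auto simp: subalgebra_def)

lemma generated_algebra_superset: "S \<subseteq> generated_algebra S"
  unfolding generated_algebra_def by (rule hull_subset)

lemma subalgebra_imp_subspace: "subalgebra A \<Longrightarrow> cpoly.subspace A"
  by (metis (no_types, lifting) Const_0 UNIV_I cpoly.subspace_def image_subset_iff subalgebra_def)

lemma subalgebra_polyring: "subalgebra (polyring n)"
  unfolding subalgebra_def
proof (intro conjI ballI)
  show "range Const \<subseteq> polyring n" by (auto simp: polyring_def Const_def split: if_splits)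
  fix f g assume fg: "f \<in> polyring n" "g \<in> polyring n"
  show "f + g \<in> polyring n" using fg keys_add[of f g] by (auto simp: polyring_def)
  show "f * g \<in> polyring n"
    unfolding polyring_def
  proof safe
    fix m i assume "m \<in> Poly_Mapping.keys (f * g)" "i \<in> Poly_Mapping.keys m"
    then obtain u v where "m = u + v" "u \<in> Poly_Mapping.keys f" "v \<in> Poly_Mapping.keys g"
      using keys_mult[of f g] by blast
    hence "i \<in> Poly_Mapping.keys u \<union> Poly_Mapping.keys v"
      using \<open>i \<in> Poly_Mapping.keys m\<close> keys_add[of u v] by blast
    moreover have "Poly_Mapping.keys u \<subseteq> {..<n}" "Poly_Mapping.keys v \<subseteq> {..<n}"
      using fg \<open>u \<in> _\<close> \<open>v \<in> _\<close> by (auto simp: polyring_def)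
    ultimately show "i < n" by blast
  qed
qed

lemma fourier_var_in_polyring: "fourier_var n z m \<in> polyring n"
proof -
  have "Const c * X j \<in> polyring n" if "j < n" for c j
    using that by (auto simp: polyring_def Const_def X_def mult_single split: if_splits)
  thus ?thesis unfolding fourier_var_def
    by (intro cpoly.subspace_sum[OF subalgebra_imp_subspace[OF subalgebra_polyring]]) simp
qed

lemma subalgebra_shift_constants: "subalgebra {f \<in> polyring n. shift_derivation n s f = 0}"
  using subalgebra_polyring[of n]
  by (auto simp: subalgebra_def shift_derivation_add shift_derivation_mult)

text \<open>A polygon in the support of \<open>a\<close> splits off one generator \<open>\<Theta>\<close> from the monomial, and the exponents
that are left form a smaller vanishing sum. The root \<open>y\<close> of the vanishing sum is independent of the
root \<open>z\<close> that defines the Fourier variables, because \<open>D\<close> and \<open>\<Delta>\<close> lead to different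
powers of \<open>z\<close>.\<close>

lemma fourier_monom_in_generated_algebra:
  fixes a :: "nat \<Rightarrow> nat"
  assumes prim: "primitive_root_of_unity n z" and n: "n > 0" and pq: "prime_factors n = {p, q}"
    and y: "primitive_root_of_unity n y" and zero: "(\<Sum>i<n. of_nat (a i) * y ^ i) = 0"
  shows "fourier_monom n z a \<in> generated_algebra
           ({Theta n z p i | i. i < n div p} \<union> {Theta n z q j | j. j < n div q})"
    (is "_ \<in> ?G")
  using zero
proof (induction "\<Sum>i<n. a i" arbitrary: a rule: less_induct)
  case less
  show ?case
  proof (cases "\<exists>i<n. a i > 0")
    case False
    hence "fourier_monom n z a = 1" by (auto simp: fourier_monom_def intro!: prod.neutral)
    thus ?thesis using subalgebra_prod[OF subalgebra_generated_algebra, of "{}"] by simp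
  next
    case True
    then obtain r h where r: "r \<in> {p, q}" and h: "h < n div r"
      and pos: "\<And>k. k < r \<Longrightarrow> a (h + k * (n div r)) > 0"
      using vanishing_sum_contains_polygon[OF y n pq less.prems] by blast
    have "r \<in> prime_factors n" using r pq by simp
    hence rn: "r dvd n" "prime r" by (auto simp: in_prime_factors_iff)
    hence r1: "r > 1" by (intro prime_gt_1_nat)
    define v where "v = (\<lambda>k. h + k * (n div r))"
    define P where "P = v ` {..<r}"
    have inj: "inj_on v {..<r}" using h by (auto simp: v_def inj_on_def)
    have P: "P \<subseteq> {..<n}"
    proof -
      have "h + k * (n div r) < n" if "k < r" for k
      proof -
        have "h + k * (n div r) < Suc k * (n div r)" using h by simp
        also have "\<dots> \<le> r * (n div r)" using that by (intro mult_le_mono1) simp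
        finally show ?thesis using rn by simp
      qed
      thus ?thesis by (auto simp: P_def v_def)
    qed
    define b where "b = (\<lambda>i. if i \<in> P then a i - 1 else a i)"
    have a: "a i = b i + (if i \<in> P then 1 else 0)" for i
      using pos by (auto simp: b_def P_def v_def)
    have theta: "Theta n z r h \<in> ?G"
    proof (rule subsetD[OF generated_algebra_superset])
      show "Theta n z r h \<in> {Theta n z p i | i. i < n div p} \<union> {Theta n z q j | j. j < n div q}"
        using r h by (elim insertE emptyE) (simp_all, metis+)
    qed
    have prod_P: "(\<Prod>i<n. if i \<in> P then fourier_var n z i else 1) = Theta n z r h"
    proof -
      have "(\<Prod>i<n. if i \<in> P then fourier_var n z i else 1) = (\<Prod>i\<in>P. fourier_var n z i)"
        using P by (simp add: prod.If_cases Int_absorb1)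
      also have "\<dots> = Theta n z r h"
        unfolding P_def by (subst prod.reindex[OF inj]) (simp add: Theta_eq_prod[OF prim n rn(1)] v_def)
      finally show ?thesis .
    qed
    have "fourier_monom n z a = (\<Prod>i<n. (if i \<in> P then fourier_var n z i else 1) * fourier_var n z i ^ b i)"
      unfolding fourier_monom_def by (intro prod.cong) (auto simp: a)
    hence split: "fourier_monom n z a = Theta n z r h * fourier_monom n z b"
      by (simp add: prod.distrib prod_P fourier_monom_def)
    have sum_P: "(\<Sum>i<n. if i \<in> P then y ^ i else 0) = 0"
    proof -
      have "(\<Sum>i<n. if i \<in> P then y ^ i else 0) = (\<Sum>i\<in>P. y ^ i)"
        using P by (simp add: sum.If_cases Int_absorb1)
      also have "\<dots> = (\<Sum>k<r. y ^ (h + k * (n div r)))"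
        unfolding P_def by (subst sum.reindex[OF inj]) (simp add: v_def)
      also have "\<dots> = y ^ h * (\<Sum>k<r. y ^ ((n div r) * 1 * k))"
        by (simp add: power_add sum_distrib_left mult_ac)
      also have "\<dots> = 0" using sum_regular_polygon[OF y n rn(1) _ r1] by simp
      finally show ?thesis .
    qed
    have "(\<Sum>i<n. of_nat (a i) * y ^ i) =
        (\<Sum>i<n. of_nat (b i) * y ^ i + (if i \<in> P then y ^ i else 0))"
      by (intro sum.cong) (auto simp: a algebra_simps)
    hence "(\<Sum>i<n. of_nat (b i) * y ^ i) = 0"
      using less.prems sum_P by (simp add: sum.distrib)
    moreover have "(\<Sum>i<n. b i) < (\<Sum>i<n. a i)"
    proof (rule sum_strict_mono_ex1)
      have "v 0 \<in> P" using r1 unfolding P_def by (intro imageI) simp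
      with P show "\<exists>i\<in>{..<n}. b i < a i" by (intro bexI[of _ "v 0"]) (auto simp: a)
    qed (auto simp: a)
    ultimately have "fourier_monom n z b \<in> ?G" by (intro less.hyps)
    with theta show ?thesis
      unfolding split by (rule subalgebra_mult[OF subalgebra_generated_algebra])
  qed
qed

text \<open>The weight of a monomial is a sum of powers of \<open>z^t\<close>, again a primitive root as \<open>t\<close> is coprime to \<open>n\<close>.
So the description of the kernel does not depend on \<open>s\<close>, which is why \<open>D\<close> and \<open>\<Delta>\<close> have
the same constants.\<close>

lemma shift_constants_eq_generated_algebra:
  assumes prim: "primitive_root_of_unity n z" and n: "n > 0" and pq: "prime_factors n = {p, q}"
    and st: "s + t = n" and t: "coprime t n"
  shows "{f \<in> polyring n. shift_derivation n s f = 0} = generated_algebra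
           ({Theta n z p i | i. i < n div p} \<union> {Theta n z q j | j. j < n div q})"
    (is "?K = generated_algebra ?S")
proof
  have zn: "z ^ n = 1" using prim by (simp add: primitive_root_of_unity_def)
  have prim': "primitive_root_of_unity n (z ^ t)" by (rule primitive_root_power_coprime[OF prim n t])
  show "?K \<subseteq> generated_algebra ?S"
  proof
    fix f assume f: "f \<in> ?K"
    let ?w = "\<lambda>a. \<Sum>i<n. of_nat (a i) * (z ^ t) ^ i"
    have "f \<in> cpoly.span (fourier_monom n z ` {a \<in> UNIV. ?w a = 0})"
    proof (rule cpoly.kernel_of_diagonal_operator[where T = "shift_derivation n s"])
      show "f \<in> cpoly.span (range (fourier_monom n z))"
        using f polyring_subset_span_fourier_monom[OF prim] by blast
    qed (use f in \<open>auto simp: shift_derivation_add shift_derivation_mult shift_derivation_fourier_monom[OF zn st]\<close>)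
    also have "\<dots> \<subseteq> generated_algebra ?S"
      using fourier_monom_in_generated_algebra[OF prim n pq prim']
      by (intro cpoly.span_minimal subalgebra_imp_subspace subalgebra_generated_algebra) auto
    finally show "f \<in> generated_algebra ?S" .
  qed
  have "Theta n z r h \<in> ?K" if r: "r \<in> {p, q}" for r h
  proof -
    have "r \<in> prime_factors n" using r pq by simp
    hence rn: "r dvd n" "prime r" by (auto simp: in_prime_factors_iff)
    hence r1: "r > 1" by (intro prime_gt_1_nat)
    have "shift_derivation n s (Theta n z r h) =
        Const (\<Sum>k<r. z ^ (t * (h + k * (n div r)))) * Theta n z r h"
      unfolding Theta_eq_prod[OF prim n rn(1)]
      by (rule shift_derivation_prod_eigen) (auto simp: shift_derivation_fourier_var[OF zn st])
    also have "(\<Sum>k<r. z ^ (t * (h + k * (n div r)))) = (z ^ t) ^ h * (\<Sum>k<r. (z ^ t) ^ ((n div r) * 1 * k))"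
      by (simp add: power_add sum_distrib_left algebra_simps flip: power_mult)
    also have "\<dots> = 0" using sum_regular_polygon[OF prim' n rn(1) _ r1] by simp
    finally have "shift_derivation n s (Theta n z r h) = 0" by simp
    moreover have "Theta n z r h \<in> polyring n"
      unfolding Theta_eq_prod[OF prim n rn(1)]
      by (rule subalgebra_prod[OF subalgebra_polyring fourier_var_in_polyring])
    ultimately show ?thesis by simp
  qed
  hence "?S \<subseteq> ?K" by blast
  thus "generated_algebra ?S \<subseteq> ?K"
    unfolding generated_algebra_def by (rule hull_minimal) (rule subalgebra_shift_constants)
qed

text \<open>The case \<open>p = q\<close> is included and settles part (1), where the two families of generators coincide.\<close>

lemma constants_eq_generated_algebra:
  assumes prim: "primitive_root_of_unity n z" and n: "n > 0" and pq: "prime_factors n = {p, q}"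
  shows "constants_D n = constants_Delta n \<and>
         constants_Delta n = generated_algebra
           ({Theta n z p i | i. i < n div p} \<union> {Theta n z q j | j. j < n div q})"
proof -
  have "coprime (n - 1) n"
    using n coprime_diff_one_left_nat by blast
  hence "constants_Delta n = generated_algebra
           ({Theta n z p i | i. i < n div p} \<union> {Theta n z q j | j. j < n div q})"
    unfolding constants_Delta_def Delta_op_eq_shift_derivation
    using n by (intro shift_constants_eq_generated_algebra[OF prim n pq]) auto
  moreover have "constants_D n = generated_algebra
           ({Theta n z p i | i. i < n div p} \<union> {Theta n z q j | j. j < n div q})"
    unfolding constants_D_def D_op_eq_shift_derivation[OF n]
    using n by (intro shift_constants_eq_generated_algebra[OF prim n pq, where t = 1]) auto
  ultimately show ?thesis by simp
qed

theorem theorem1: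
  fixes n :: nat and \<zeta> :: complex
  assumes "n > 0" and "primitive_root_of_unity n \<zeta>"
  shows "(\<forall>p. prime_factors n = {p} \<longrightarrow>
            constants_D n = constants_Delta n \<and>
            constants_Delta n = generated_algebra {Theta n \<zeta> p i | i. i < n div p}) \<and>
         (\<forall>p q. p \<noteq> q \<and> prime_factors n = {p, q} \<longrightarrow>
            constants_D n = constants_Delta n \<and>
            constants_Delta n = generated_algebra
              ({Theta n \<zeta> p i | i. i < n div p} \<union> {Theta n \<zeta> q j | j. j < n div q}))"
proof -
  note main = constants_eq_generated_algebra[OF assms(2,1)]
  show ?thesis
  proof (intro conjI allI impI)
    fix p assume "prime_factors n = {p}"
    hence "prime_factors n = {p, p}" by simp
    from main[OF this] show "constants_D n = constants_Delta n"
      "constants_Delta n = generated_algebra {Theta n \<zeta> p i | i. i < n div p}" by simp_all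
  next
    fix p q assume "p \<noteq> q \<and> prime_factors n = {p, q}"
    with main[of p q] show "constants_D n = constants_Delta n"
      "constants_Delta n = generated_algebra
         ({Theta n \<zeta> p i | i. i < n div p} \<union> {Theta n \<zeta> q j | j. j < n div q})" by simp_all
  qed
qed

end
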